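(* For any integer $a\in\mathbb{Z}$, we have $$\sum_{r=0}^\infty [r+1]_{q^{a}}\,[r+1]_{q}^2\,t^r=\frac{1+q(q^a+1)t-2(q^2+q+1)q^{a+1}t^2+(q^a+1)q^{a+3}t^3+q^{2a+4}t^4}{(1-t)(1-qt)(1-q^2t)(1-q^at)(1-q^{a+1}t)(1-q^{a+2}t)}.$$
   Context: For a positive integer $k$, $[k]_q=\frac{1-q^k}{1-q}=1+q+\cdots+q^{k-1}$ is the $q$-integer, and $[k]_{q^a}=\sum_{i=0}^{k-1}q^{ia}$ is the result of substituting $q^a$ for $q$ (so $[k]_{q^0}=k$). The identity is one of formal power series in $t$ with coefficients in $\mathbb{Z}[q,q^{-1}]$. *)

theory Defs
  imports "HOL-Computational_Algebra.Formal_Power_Series" "HOL-Library.Poly_Mapping"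
begin

text \<open>
  The ring of Laurent polynomials in \<open>q\<close> with integer coefficients, encoded as the
  group ring of the additive group of the integers: finitely supported maps from exponents
  to coefficients, multiplied by convolution.
\<close>

type_synonym laurent_poly = "int \<Rightarrow>\<^sub>0 int"

definition qpow :: "int \<Rightarrow> laurent_poly" where
  "qpow n = Poly_Mapping.single n 1"

lemma qpow_0: "qpow 0 = 1"
  by (simp add: qpow_def)

lemma qpow_add: "qpow (m + n) = qpow m * qpow n"
  by (simp add: qpow_def mult_single)

text \<open>\<open>q_int a k\<close> is $[k]_{q^a}$, so \<open>q_int 1 k\<close> is $[k]_q$.\<close>

definition q_int :: "int \<Rightarrow> nat \<Rightarrow> laurent_poly" where
  "q_int a k = (\<Sum>i<k. qpow (int i * a))"

lemma q_int_geometric: "(1 - qpow a) * q_int a k = 1 - qpow (int k * a)"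
proof (induction k)
  case 0
  show ?case
    by (simp add: q_int_def qpow_0)
next
  case (Suc k)
  have "(1 - qpow a) * q_int a (Suc k) = (1 - qpow a) * q_int a k + (1 - qpow a) * qpow (int k * a)"
    by (simp add: q_int_def distrib_left)
  also have "\<dots> = 1 - qpow a * qpow (int k * a)"
    by (simp only: Suc.IH) (simp add: left_diff_distrib)
  also have "qpow a * qpow (int k * a) = qpow (int (Suc k) * a)"
    by (simp add: distrib_right flip: qpow_add)
  finally show ?case .
qed

text \<open>
  The library's division of power series needs inverses in the coefficient ring.
  Over an arbitrary commutative ring a quotient still makes sense whenever the denominator
  has constant term 1, and \<open>fps_frac\<close> is meaningful only in that case.
\<close>

definition fps_frac :: "'a::comm_ring_1 fps \<Rightarrow> 'a fps \<Rightarrow> 'a fps" where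
  "fps_frac f g = f * fps_right_inverse g 1"

lemma fps_frac_eq_iff:
  fixes f g h :: "'a::comm_ring_1 fps"
  assumes "fps_nth g 0 = 1"
  shows "h = fps_frac f g \<longleftrightarrow> h * g = f"
proof -
  have inv: "g * fps_right_inverse g 1 = 1"
    using assms by (intro fps_right_inverse) simp
  show ?thesis
  proof
    assume "h = fps_frac f g"
    then have "h * g = f * (g * fps_right_inverse g 1)"
      by (simp only: fps_frac_def ac_simps)
    then show "h * g = f"
      by (simp only: inv mult_1_right)
  next
    assume "h * g = f"
    then have "fps_frac f g = (h * g) * fps_right_inverse g 1"
      by (simp only: fps_frac_def)
    then have "fps_frac f g = h * (g * fps_right_inverse g 1)"
      by (simp only: fps_frac_def mult.assoc)
    then show "h = fps_frac f g"
      by (simp only: inv mult_1_right)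
  qed
qed

end

theory Submission
  imports Defs
begin

text \<open>
  Write \<open>A\<close> for $q^a$, $S_r = 1 + A + \cdots + A^r$ and $Q_r = 1 + q + \cdots + q^r$. The identity
  is polynomial in \<open>A\<close> and \<open>q\<close>, so it can be proved for arbitrary elements of a commutative ring
  (\<open>rational_gf_sum_times_sum_squared\<close>). At this generality $1 - A$ and $1 - q$ may be zero
  divisors, and $1 - q^a$ is indeed zero for $a = 0$. Hence $S_r Q_r^2$ cannot be expanded as
  $(1 - A^{r+1})(1 - q^{r+1})^2$ over a common denominator.

  Instead, $S_{r+1} = A^{r+1} + S_r$ and $Q_{r+1} = 1 + q\,Q_r$ give
  $$S_{r+1} Q_{r+1}^j = A^{r+1} Q_{r+1}^j + S_r (1 + q\,Q_r)^j, \qquad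
    A^{r+1} Q_{r+1}^j = A \cdot A^r (1 + q\,Q_r)^j.$$
  Expanding the powers for $j = 0, 1, 2$ yields six linear equations between the generating
  functions of $A^r Q_r^j$ and $S_r Q_r^j$. The system is triangular, and its diagonal entries
  $1 - A q^j t$ and $1 - q^j t$ are exactly the six factors of the denominator; solving it by
  multiplication alone (\<open>triangular_system_solution\<close>) produces the numerator.
\<close>

text \<open>
  A recurrence that expresses the coefficient at \<open>Suc r\<close> through coefficients at \<open>r\<close> becomes an
  equation of power series in this way; the series \<open>g\<close> carries the initial value and the
  inhomogeneous part.
\<close>

lemma fps_eq_add_X_mult:
  fixes f g h :: "nat \<Rightarrow> 'a::comm_ring_1"
  assumes "f 0 = g 0" and "\<And>r. f (Suc r) = g (Suc r) + h r"
  shows "Abs_fps f = Abs_fps g + fps_X * Abs_fps h"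
proof (rule fps_ext)
  fix n
  show "fps_nth (Abs_fps f) n = fps_nth (Abs_fps g + fps_X * Abs_fps h) n"
    using assms by (cases n) simp_all
qed

text \<open>
  The hypotheses are the linear system relating the generating functions: \<open>Gj\<close> stands for that of
  $A^r Q_r^j$ and \<open>Ej\<close> for that of $S_r Q_r^j$. Multiplying an equation by the diagonal entries
  of the earlier ones replaces every unknown on its right-hand side by a polynomial. This
  collects the factors \<open>1 - A * t\<close>, \<open>1 - A * q * t\<close>, \<open>1 - A * q\<^sup>2 * t\<close> from the first three
  equations and \<open>1 - t\<close>, \<open>1 - q * t\<close>, \<open>1 - q\<^sup>2 * t\<close> from the last three.
\<close>

lemma triangular_system_solution:
  fixes q A t :: "'a::comm_ring_1"
  assumes G0: "G0 = 1 + t * (A * G0)"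
    and G1: "G1 = G0 + t * (A * q * G1)"
    and G2: "G2 = G0 + t * (A * (2 * q * G1 + q\<^sup>2 * G2))"
    and E0: "E0 = G0 + t * E0"
    and E1: "E1 = G1 + t * (E0 + q * E1)"
    and E2: "E2 = G2 + t * (E0 + 2 * q * E1 + q\<^sup>2 * E2)"
  shows "E2 * ((1 - t) * (1 - q * t) * (1 - q\<^sup>2 * t)
           * (1 - A * t) * (1 - A * q * t) * (1 - A * q\<^sup>2 * t))
         = 1 + q * (A + 1) * t - 2 * (q\<^sup>2 + q + 1) * (A * q) * t\<^sup>2
           + (A + 1) * (A * q ^ 3) * t ^ 3 + A\<^sup>2 * q ^ 4 * t ^ 4"
proof -
  define a0 a1 a2 where "a0 = 1 - A * t" and "a1 = 1 - A * q * t" and "a2 = 1 - A * q\<^sup>2 * t"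
  define b0 b1 b2 where "b0 = 1 - t" and "b1 = 1 - q * t" and "b2 = 1 - q\<^sup>2 * t"
  note factor_defs = a0_def a1_def a2_def b0_def b1_def b2_def
  have G0': "G0 * a0 = 1" and G1': "G1 * a1 = G0" and G2': "G2 * a2 = G0 + 2 * A * q * t * G1"
    using G0 G1 G2 by (simp_all add: factor_defs algebra_simps)
  have E0': "E0 * b0 = G0" and E1': "E1 * b1 = G1 + t * E0"
    and E2': "E2 * b2 = G2 + t * E0 + 2 * q * t * E1"
    using E0 E1 E2 by (simp_all add: factor_defs algebra_simps)
  have g1: "G1 * a1 * a0 = 1"
    by (simp only: G1' G0')
  have g2: "G2 * a2 * a1 * a0 = 1 + A * q * t"
  proof -
    have "G2 * a2 * a1 * a0 = (G0 * a0) * a1 + 2 * A * q * t * (G1 * a1 * a0)"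
      unfolding G2' by (simp add: algebra_simps eval_nat_numeral)
    also have "\<dots> = 1 + A * q * t"
      unfolding G0' g1 by (simp add: a1_def algebra_simps eval_nat_numeral)
    finally show ?thesis .
  qed
  have e0: "E0 * b0 * a0 = 1"
    by (simp only: E0' G0')
  have e1: "E1 * b1 * b0 * a1 * a0 = 1 - A * q * t\<^sup>2"
  proof -
    have "E1 * b1 * b0 * a1 * a0 = (G1 * a1 * a0) * b0 + t * (E0 * b0 * a0) * a1"
      unfolding E1' by (simp add: algebra_simps eval_nat_numeral)
    also have "\<dots> = 1 - A * q * t\<^sup>2"
      unfolding g1 e0 by (simp add: a1_def b0_def algebra_simps eval_nat_numeral)
    finally show ?thesis .
  qed
  have "E2 * (b0 * b1 * b2 * a0 * a1 * a2) = (E2 * b2) * (b0 * b1 * a0 * a1 * a2)"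
    by (simp add: algebra_simps eval_nat_numeral)
  also have "\<dots> = (G2 * a2 * a1 * a0) * b0 * b1 + t * (E0 * b0 * a0) * b1 * a1 * a2
      + 2 * q * t * (E1 * b1 * b0 * a1 * a0) * a2"
    unfolding E2' by (simp add: algebra_simps eval_nat_numeral)
  also have "\<dots> = (1 + A * q * t) * (1 - t) * (1 - q * t)
      + t * (1 - q * t) * (1 - A * q * t) * (1 - A * q\<^sup>2 * t)
      + 2 * q * t * (1 - A * q * t\<^sup>2) * (1 - A * q\<^sup>2 * t)"
    unfolding g2 e0 e1 by (simp add: factor_defs)
  also have "\<dots> = 1 + q * (A + 1) * t - 2 * (q\<^sup>2 + q + 1) * (A * q) * t\<^sup>2
           + (A + 1) * (A * q ^ 3) * t ^ 3 + A\<^sup>2 * q ^ 4 * t ^ 4"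
    by (simp add: algebra_simps eval_nat_numeral)
  finally show ?thesis
    by (simp only: factor_defs)
qed

lemma rational_gf_sum_times_sum_squared:
  fixes q A :: "'a::comm_ring_1"
  defines "t \<equiv> fps_X" and "cq \<equiv> fps_const q" and "cA \<equiv> fps_const A"
  shows "Abs_fps (\<lambda>r. (\<Sum>i<Suc r. A ^ i) * (\<Sum>i<Suc r. q ^ i)\<^sup>2)
           * ((1 - t) * (1 - cq * t) * (1 - cq\<^sup>2 * t)
              * (1 - cA * t) * (1 - cA * cq * t) * (1 - cA * cq\<^sup>2 * t))
         = 1 + cq * (cA + 1) * t - 2 * (cq\<^sup>2 + cq + 1) * (cA * cq) * t\<^sup>2
           + (cA + 1) * (cA * cq ^ 3) * t ^ 3 + cA\<^sup>2 * cq ^ 4 * t ^ 4"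
proof -
  define S where "S r = (\<Sum>i<Suc r. A ^ i)" for r
  define Q where "Q r = (\<Sum>i<Suc r. q ^ i)" for r
  have S0 [simp]: "S 0 = 1" and Q0 [simp]: "Q 0 = 1"
    by (simp_all add: S_def Q_def)
  have S_Suc: "S (Suc r) = A ^ Suc r + S r" for r
    by (simp add: S_def)
  have Q_Suc: "Q (Suc r) = 1 + q * Q r" for r
    unfolding Q_def by (subst sum.lessThan_Suc_shift) (simp add: sum_distrib_left del: sum.lessThan_Suc)
  define G where "G j = Abs_fps (\<lambda>r. A ^ r * Q r ^ j)" for j :: nat
  define E where "E j = Abs_fps (\<lambda>r. S r * Q r ^ j)" for j :: nat
  have two: "(2 :: 'a fps) = fps_const 2"
    by (simp add: numeral_fps_const)
  have one: "1 = Abs_fps (\<lambda>r. if r = 0 then 1 else 0 :: 'a)"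
    by (rule fps_ext) simp
  have scale: "fps_const c * Abs_fps f = Abs_fps (\<lambda>r. c * f r)" for c :: 'a and f
    by (rule fps_ext) simp
  have plus: "Abs_fps f + Abs_fps g = Abs_fps (\<lambda>r. f r + g r)" for f g :: "nat \<Rightarrow> 'a"
    by (rule fps_ext) simp
  \<comment> \<open>Both sides of each equation below are brought into the form \<open>Abs_fps\<close> of one explicit
    coefficient function, so that the recurrences apply coefficientwise.\<close>
  note to_coeffs = G_def E_def t_def cq_def cA_def two scale plus
    fps_const_mult fps_const_power
  have "G 0 = 1 + t * (cA * G 0)"
    unfolding to_coeffs one by (rule fps_eq_add_X_mult) simp_all
  moreover have "G 1 = G 0 + t * (cA * cq * G 1)"
    unfolding to_coeffs by (rule fps_eq_add_X_mult) (simp_all add: Q_Suc algebra_simps)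
  moreover have "G 2 = G 0 + t * (cA * (2 * cq * G 1 + cq\<^sup>2 * G 2))"
    unfolding to_coeffs
    by (rule fps_eq_add_X_mult) (simp_all add: Q_Suc power2_eq_square algebra_simps)
  moreover have "E 0 = G 0 + t * E 0"
    unfolding to_coeffs by (rule fps_eq_add_X_mult) (simp_all add: S_Suc)
  moreover have "E 1 = G 1 + t * (E 0 + cq * E 1)"
    unfolding to_coeffs
    by (rule fps_eq_add_X_mult) (simp_all add: S_Suc Q_Suc algebra_simps)
  moreover have "E 2 = G 2 + t * (E 0 + 2 * cq * E 1 + cq\<^sup>2 * E 2)"
    unfolding to_coeffs
    by (rule fps_eq_add_X_mult) (simp_all add: S_Suc Q_Suc power2_eq_square algebra_simps)
  ultimately have "E 2 * ((1 - t) * (1 - cq * t) * (1 - cq\<^sup>2 * t)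
           * (1 - cA * t) * (1 - cA * cq * t) * (1 - cA * cq\<^sup>2 * t))
         = 1 + cq * (cA + 1) * t - 2 * (cq\<^sup>2 + cq + 1) * (cA * cq) * t\<^sup>2
           + (cA + 1) * (cA * cq ^ 3) * t ^ 3 + cA\<^sup>2 * cq ^ 4 * t ^ 4"
    by (rule triangular_system_solution)
  then show ?thesis
    by (simp only: E_def S_def Q_def)
qed

lemma qpow_mult_nat: "qpow (int n * a) = qpow a ^ n"
  by (induction n) (simp_all add: qpow_0 qpow_add distrib_right)

lemma q_int_eq_sum_powers: "q_int a k = (\<Sum>i<k. qpow a ^ i)"
  by (simp add: q_int_def qpow_mult_nat)

theorem corollary2p6:
  fixes a :: int
  defines "t \<equiv> (fps_X :: laurent_poly fps)"
  shows "Abs_fps (\<lambda>r. q_int a (r + 1) * q_int 1 (r + 1) ^ 2) =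
    fps_frac
      (1 + fps_const (qpow 1 * (qpow a + 1)) * t
         - fps_const (2 * (qpow 2 + qpow 1 + 1) * qpow (a + 1)) * t ^ 2
         + fps_const ((qpow a + 1) * qpow (a + 3)) * t ^ 3
         + fps_const (qpow (2 * a + 4)) * t ^ 4)
      ((1 - t) * (1 - fps_const (qpow 1) * t) * (1 - fps_const (qpow 2) * t)
         * (1 - fps_const (qpow a) * t) * (1 - fps_const (qpow (a + 1)) * t)
         * (1 - fps_const (qpow (a + 2)) * t))"
    (is "?F = fps_frac ?N ?D")
proof -
  have "fps_nth ?D 0 = 1"
    by (simp add: t_def)
  moreover have "?F * ?D = ?N"
  proof -
    have q: "qpow 2 = qpow 1 ^ 2" "qpow 3 = qpow 1 ^ 3" "qpow 4 = qpow 1 ^ 4"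
      and A: "qpow (2 * a) = qpow a ^ 2"
      using qpow_mult_nat [of 2 1] qpow_mult_nat [of 3 1] qpow_mult_nat [of 4 1]
        qpow_mult_nat [of 2 a] by simp_all
    have two: "fps_const (2 :: laurent_poly) = 2"
      by (simp add: numeral_fps_const)
    have const: "fps_const (x + y) = fps_const x + fps_const y"
      "fps_const (x * y) = fps_const x * fps_const y"
      "fps_const (x ^ n) = fps_const x ^ n" for x y :: laurent_poly and n
      by (simp_all add: fps_const_power)
    show ?thesis
      using rational_gf_sum_times_sum_squared [of "qpow a" "qpow 1"]
      by (simp only: t_def q_int_eq_sum_powers Suc_eq_plus1 qpow_add q A two const
          fps_const_1_eq_1)
  qed
  ultimately show ?thesis
    by (simp only: fps_frac_eq_iff)
qed

end
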